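(* Let $\mathcal{G}_1$ and $\mathcal{G}_2$ be DAGs on the same finite vertex set $V$. If $\mathcal{M}_{\mathcal{G}_1}=\mathcal{M}_{\mathcal{G}_2}$ then $\mathcal{G}_1$ and $\mathcal{G}_2$ are Markov equivalent as Bayesian networks. In other words, the partition of the DAGs on $V$ into model equivalence classes of graphical continuous Lyapunov models is a refinement of the partition into Markov equivalence classes of Bayesian network models: if two DAGs are not Markov equivalent, then they are not model equivalent as graphical continuous Lyapunov models.
   Context: All graphs are finite directed graphs $\mathcal{G}=(V,E)$ without multiple edges, whose edge set $E\subseteq V\times V$ contains every self-loop $i\to i$, $i\in V$. Self-loops are ignored for acyclicity, d-separation, skeletons and v-structures. A DAG is a graph with no directed cycle of length greater than one. $\mathbb{R}^E$ is the set of real $V\times V$ matrices $M$ with $m_{ji}=0$ whenever $i\to j\notin E$; a matrix is stable if all its eigenvalues have strictly negative real part; $\mathrm{PD}_V$ is the set of real symmetric positive definite $V\times V$ matrices. The graphical continuous Lyapunov model of $\mathcal{G}$ is $\mathcal{M}_{\mathcal{G}}=\{\Sigma\in\mathrm{PD}_V : M\Sigma+\Sigma M^T+2I=0\text{ for some stable }M\in\mathbb{R}^E\}$; two graphs are model equivalent if these sets coincide. Two DAGs are Markov equivalent (as Bayesian networks) if they have the same d-separations; equivalently (Verma and Pearl), if they have the same skeleton (underlying undirected graph) and the same v-structures (induced subgraphs $i\to k\leftarrow j$ with $i,j$ distinct and non-adjacent). *)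

theory Defs
  imports "HOL-Analysis.Analysis" "HOL-Library.Disjoint_Sets"
begin

section \<open>Directed graphs\<close>

text \<open>
  The vertex set \<open>V\<close> is the universe of a finite type \<open>'v\<close>; a graph is its edge set, where
  \<open>(i, j)\<close> stands for the edge from \<open>i\<close> to \<open>j\<close>. Every self-loop is an edge. The relation
  \<open>arcs E\<close> forgets the self-loops, which play no role for acyclicity and d-separation.
\<close>

definition digraph :: "('v::finite \<times> 'v) set \<Rightarrow> bool" where
  "digraph E \<longleftrightarrow> Id \<subseteq> E"

definition arcs :: "('v \<times> 'v) set \<Rightarrow> ('v \<times> 'v) set" where
  "arcs E = E - Id"

definition dag :: "('v::finite \<times> 'v) set \<Rightarrow> bool" where
  "dag E \<longleftrightarrow> digraph E \<and> acyclic (arcs E)"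


section \<open>Graphical continuous Lyapunov models\<close>

text \<open>An edge from \<open>i\<close> to \<open>j\<close> allows the entry in row \<open>j\<close> and column \<open>i\<close> to be nonzero.\<close>

definition edge_matrices :: "('v::finite \<times> 'v) set \<Rightarrow> (real ^ 'v ^ 'v) set" where
  "edge_matrices E = {M. \<forall>i j. (i, j) \<notin> E \<longrightarrow> M $ j $ i = 0}"

definition complex_eigenvalue :: "real ^ 'v ^ 'v::finite \<Rightarrow> complex \<Rightarrow> bool" where
  "complex_eigenvalue M l \<longleftrightarrow>
     (\<exists>x :: complex ^ 'v. x \<noteq> 0 \<and> map_matrix complex_of_real M *v x = l *s x)"

definition stable :: "real ^ 'v ^ 'v::finite \<Rightarrow> bool" where
  "stable M \<longleftrightarrow> (\<forall>l. complex_eigenvalue M l \<longrightarrow> Re l < 0)"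

definition positive_definite :: "real ^ 'v ^ 'v::finite \<Rightarrow> bool" where
  "positive_definite S \<longleftrightarrow> transpose S = S \<and> (\<forall>x. x \<noteq> 0 \<longrightarrow> x \<bullet> (S *v x) > 0)"

definition lyapunov_model :: "('v::finite \<times> 'v) set \<Rightarrow> (real ^ 'v ^ 'v) set" where
  "lyapunov_model E = {S. positive_definite S \<and>
     (\<exists>M \<in> edge_matrices E. stable M \<and> M ** S + S ** transpose M + 2 *\<^sub>R mat 1 = 0)}"

definition model_equivalent :: "('v::finite \<times> 'v) set \<Rightarrow> ('v \<times> 'v) set \<Rightarrow> bool" where
  "model_equivalent E F \<longleftrightarrow> lyapunov_model E = lyapunov_model F"


section \<open>d-separation and Markov equivalence\<close>

text \<open>A path follows arcs in either direction and visits no vertex twice.\<close>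

definition upath :: "('v \<times> 'v) set \<Rightarrow> 'v list \<Rightarrow> bool" where
  "upath E p \<longleftrightarrow> p \<noteq> [] \<and> distinct p \<and>
     (\<forall>k. Suc k < length p \<longrightarrow>
        (p ! k, p ! Suc k) \<in> arcs E \<or> (p ! Suc k, p ! k) \<in> arcs E)"

definition collider_at :: "('v \<times> 'v) set \<Rightarrow> 'v list \<Rightarrow> nat \<Rightarrow> bool" where
  "collider_at E p k \<longleftrightarrow>
     (p ! (k - 1), p ! k) \<in> arcs E \<and> (p ! (k + 1), p ! k) \<in> arcs E"

text \<open>
  A path is active given \<open>C\<close> if every interior collider is in \<open>C\<close> or has a descendant
  in \<open>C\<close>, and every interior non-collider is outside \<open>C\<close>. The endpoints need no condition:
  below they always lie outside \<open>C\<close>.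
\<close>

definition active_path :: "('v \<times> 'v) set \<Rightarrow> 'v set \<Rightarrow> 'v list \<Rightarrow> bool" where
  "active_path E C p \<longleftrightarrow> upath E p \<and>
     (\<forall>k. 0 < k \<and> k + 1 < length p \<longrightarrow>
        (if collider_at E p k then \<exists>c\<in>C. (p ! k, c) \<in> (arcs E)\<^sup>* else p ! k \<notin> C))"

definition d_separated :: "('v \<times> 'v) set \<Rightarrow> 'v set \<Rightarrow> 'v set \<Rightarrow> 'v set \<Rightarrow> bool" where
  "d_separated E A B C \<longleftrightarrow> \<not> (\<exists>p. active_path E C p \<and> hd p \<in> A \<and> last p \<in> B)"

definition markov_equivalent :: "('v::finite \<times> 'v) set \<Rightarrow> ('v \<times> 'v) set \<Rightarrow> bool" where
  "markov_equivalent E F \<longleftrightarrow>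
     (\<forall>A B C. A \<inter> B = {} \<and> A \<inter> C = {} \<and> B \<inter> C = {} \<longrightarrow>
        (d_separated E A B C \<longleftrightarrow> d_separated F A B C))"


section \<open>Equivalence classes of DAGs\<close>

definition dags :: "('v::finite \<times> 'v) set set" where
  "dags = {E. dag E}"

definition model_classes :: "('v::finite \<times> 'v) set set set" where
  "model_classes = dags // {(E, F). E \<in> dags \<and> F \<in> dags \<and> model_equivalent E F}"

definition markov_classes :: "('v::finite \<times> 'v) set set set" where
  "markov_classes = dags // {(E, F). E \<in> dags \<and> F \<in> dags \<and> markov_equivalent E F}"

end

theory Submission
  imports Defs
begin

text \<open>
  If no parent of \<open>i\<close> or of \<open>j\<close> is correlated with \<open>i\<close> or \<open>j\<close>, the \<open>(i, j)\<close> entry of the Lyapunov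
  equation reduces to \<open>(m\<^sub>i\<^sub>i + m\<^sub>j\<^sub>j) s\<^sub>i\<^sub>j = 0\<close> with negative \<open>m\<^sub>i\<^sub>i\<close> and \<open>m\<^sub>j\<^sub>j\<close>, so \<open>s\<^sub>i\<^sub>j = 0\<close>.
  This kills the correlation of non-adjacent \<open>i, j\<close> in any matrix that is diagonal outside
  \<open>{i, j}\<close>, and of the ends of a v-structure \<open>i \<rightarrow> k \<leftarrow> j\<close> in any matrix that is diagonal outside
  \<open>{i, k, j}\<close>. On the other hand an edge, a chain and a fork each carry such a matrix with
  nonzero \<open>s\<^sub>i\<^sub>j\<close>. Hence the model determines the skeleton and the v-structures.

  For the theorem of Verma and Pearl, take among the shortest active trails one whose vertices
  have the least total distance to \<open>C\<close>. Its chains and colliders are unshielded, because otherwise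
  the trail could be shortened; its shielded forks are adjacent to an unshielded collider, which
  keeps them forks or chains in the other graph; and the shortest directed path from a collider
  to \<open>C\<close> is again directed in the other graph, because otherwise the collider could be moved one
  step towards \<open>C\<close>.
\<close>

section \<open>The theorem of Verma and Pearl\<close>

definition adj :: "('a \<times> 'a) set \<Rightarrow> 'a \<Rightarrow> 'a \<Rightarrow> bool" where
  "adj R x y \<longleftrightarrow> (x, y) \<in> R \<or> (y, x) \<in> R"

definition open_at :: "('a \<times> 'a) set \<Rightarrow> 'a set \<Rightarrow> 'a \<Rightarrow> 'a \<Rightarrow> 'a \<Rightarrow> bool" where
  "open_at R C x y z \<longleftrightarrow>
     (if (x, y) \<in> R \<and> (z, y) \<in> R then \<exists>c\<in>C. (y, c) \<in> R\<^sup>* else y \<notin> C)"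

text \<open>Activity for walks instead of paths: repeated vertices are allowed, so that trails can
  be cut and spliced freely; distinctness is recovered later from minimal length.\<close>

fun trail :: "('a \<times> 'a) set \<Rightarrow> 'a set \<Rightarrow> 'a list \<Rightarrow> bool" where
  "trail R C [] \<longleftrightarrow> False"
| "trail R C [x] \<longleftrightarrow> True"
| "trail R C [x, y] \<longleftrightarrow> adj R x y"
| "trail R C (x # y # z # p) \<longleftrightarrow> adj R x y \<and> open_at R C x y z \<and> trail R C (y # z # p)"

lemma adj_sym: "adj R x y \<longleftrightarrow> adj R y x"
  by (auto simp: adj_def)

lemma open_at_sym: "open_at R C x y z \<longleftrightarrow> open_at R C z y x"
  by (auto simp: open_at_def)

lemma trail_Cons:
  "trail R C (x # p) \<longleftrightarrow> p = [] \<or> adj R x (hd p) \<and> trail R C p \<and>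
     (tl p \<noteq> [] \<longrightarrow> open_at R C x (hd p) (hd (tl p)))"
  by (cases "(R, C, x # p)" rule: trail.cases) auto

lemma trail_join:
  "trail R C (xs @ x # ys) \<longleftrightarrow> trail R C (xs @ [x]) \<and> trail R C (x # ys) \<and>
     (xs \<noteq> [] \<longrightarrow> ys \<noteq> [] \<longrightarrow> open_at R C (last xs) x (hd ys))"
proof (induction xs)
  case Nil
  then show ?case by simp
next
  case (Cons a xs)
  show ?case
  proof (cases xs)
    case Nil
    then show ?thesis by (auto simp: trail_Cons[of _ _ a])
  next
    case (Cons b bs)
    then show ?thesis using Cons.IH by (cases bs) auto
  qed
qed

lemma trail_rev: "trail R C (rev p) \<longleftrightarrow> trail R C p"
proof (induction p)
  case Nil
  then show ?case by simp
next
  case (Cons a p)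
  show ?case
  proof (cases p)
    case Nil
    then show ?thesis by simp
  next
    case (Cons b q)
    have "trail R C (rev q @ b # [a]) \<longleftrightarrow> trail R C (rev q @ [b]) \<and> adj R b a \<and>
        (q \<noteq> [] \<longrightarrow> open_at R C (hd q) b a)"
      by (subst trail_join) (auto simp: last_rev)
    with Cons Cons.IH show ?thesis
      by (auto simp: trail_Cons[of R C a] adj_sym[of _ a] open_at_sym[of _ _ a])
  qed
qed

text \<open>Dropping \<open>v\<close> affects activity only at \<open>u\<close> and
  \<open>w\<close>, so only these two vertices have to be rechecked.\<close>

lemma trail_shortcut:
  assumes "trail R C (xs @ u # v # w # ys)" and "adj R u w"
    and "xs \<noteq> [] \<Longrightarrow> open_at R C (last xs) u v \<Longrightarrow> open_at R C (last xs) u w"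
    and "ys \<noteq> [] \<Longrightarrow> open_at R C v w (hd ys) \<Longrightarrow> open_at R C u w (hd ys)"
  shows "trail R C (xs @ u # w # ys)"
  using assms trail_join[of R C xs u "v # w # ys"] trail_join[of R C xs u "w # ys"]
  by (auto simp: trail_Cons[of R C u] trail_Cons[of R C v])

text \<open>Arcs are followed forward from \<open>t\<close>: either they never reverse and form a
  directed path to the end, or the first reversal is an active collider, whose descendant in
  \<open>C\<close> is also one of \<open>x\<close>.\<close>

lemma trail_out_arc:
  assumes "trail R C (t # x # q)" and "(t, x) \<in> R"
  shows "(\<exists>c\<in>C. (x, c) \<in> R\<^sup>*) \<or> (t, last (x # q)) \<in> R\<^sup>+"
  using assms
proof (induction q arbitrary: t x)
  case Nil
  then show ?case by auto
next
  case (Cons y q)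
  show ?case
  proof (cases "(y, x) \<in> R")
    case True
    with Cons.prems show ?thesis by (auto simp: open_at_def)
  next
    case False
    then have xy: "(x, y) \<in> R" using Cons.prems by (auto simp: trail_Cons[of _ _ x] adj_def)
    have "trail R C (x # y # q)" using Cons.prems by simp
    from Cons.IH[OF this xy] Cons.prems(2) xy show ?thesis
      by (auto intro: converse_rtrancl_into_rtrancl trancl_into_trancl2)
  qed
qed

lemma trail_cut_cycle:
  assumes ac: "acyclic R" and p: "trail R C (xs @ x # ys @ x # zs)"
  shows "trail R C (xs @ x # zs)"
proof -
  have j1: "trail R C (xs @ [x])" "trail R C (x # ys @ x # zs)"
    "xs \<noteq> [] \<Longrightarrow> open_at R C (last xs) x (hd (ys @ x # zs))"
    using p trail_join[of R C xs x "ys @ x # zs"] by auto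
  have j2: "trail R C (x # ys @ [x])" "trail R C (x # zs)"
    "zs \<noteq> [] \<Longrightarrow> open_at R C (last (x # ys)) x (hd zs)"
    using j1(2) trail_join[of R C "x # ys" x zs] by auto
  have irr: "(x, x) \<notin> R" using ac by (auto simp: acyclic_def)
  have ys: "ys \<noteq> []" using j2(1) irr by (auto simp: adj_def)
  have "open_at R C (last xs) x (hd zs)" if ne: "xs \<noteq> []" "zs \<noteq> []"
  proof -
    have o1: "open_at R C (last xs) x (hd ys)" using j1(3) ne ys by simp
    have o2: "open_at R C (last ys) x (hd zs)" using j2(3) ne ys by simp
    show ?thesis
    proof (cases "(last xs, x) \<in> R \<and> (hd zs, x) \<in> R")
      case False
      \<comment> \<open>A non-collider after the cut was already a non-collider at one of the two
        visits to \<open>x\<close>.\<close>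
      then have "x \<notin> C" using o1 o2 by (auto simp: open_at_def split: if_splits)
      with False show ?thesis by (auto simp: open_at_def)
    next
      case True
      have "\<exists>c\<in>C. (x, c) \<in> R\<^sup>*"
      proof (cases "(hd ys, x) \<in> R")
        case hx: True
        with o1 True show ?thesis by (auto simp: open_at_def)
      next
        case False
        from ys obtain y ys' where y: "ys = y # ys'" by (cases ys) auto
        have xy: "(x, y) \<in> R" using False j2(1) by (auto simp: y trail_Cons[of _ _ x] adj_def)
        have "trail R C (x # y # ys' @ [x])" using j2(1) y by simp
        \<comment> \<open>The loop leaves \<open>x\<close> forwards and ends in \<open>x\<close>; a
          fully directed loop would be a cycle, so \<open>x\<close> has a descendant in
          \<open>C\<close>.\<close>
        from trail_out_arc[OF this xy] ac xy show ?thesis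
          by (auto simp: acyclic_def intro: converse_rtrancl_into_rtrancl)
      qed
      with True show ?thesis by (auto simp: open_at_def)
    qed
  qed
  then show ?thesis using trail_join[of R C xs x zs] j1(1) j2(2) by auto
qed

lemma trail_iff:
  "trail R C p \<longleftrightarrow> p \<noteq> [] \<and>
     (\<forall>k. Suc k < length p \<longrightarrow> adj R (p ! k) (p ! Suc k)) \<and>
     (\<forall>k. Suc (Suc k) < length p \<longrightarrow> open_at R C (p ! k) (p ! Suc k) (p ! Suc (Suc k)))"
proof (induction R C p rule: trail.induct)
  case (4 R C x y z p)
  have all_nat: "(\<forall>k. P k) \<longleftrightarrow> P 0 \<and> (\<forall>k. P (Suc k))" for P :: "nat \<Rightarrow> bool"
    by (metis not0_implies_Suc)
  show ?case
    by (subst (1 2) all_nat) (use 4 in \<open>simp add: conj_ac\<close>)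
qed (auto simp: less_Suc_eq)

lemma active_path_iff: "active_path E C p \<longleftrightarrow> distinct p \<and> trail (arcs E) C p"
proof -
  have "(\<forall>k. 0 < k \<and> k + 1 < length p \<longrightarrow>
        (if collider_at E p k then \<exists>c\<in>C. (p ! k, c) \<in> (arcs E)\<^sup>* else p ! k \<notin> C)) \<longleftrightarrow>
     (\<forall>k. Suc (Suc k) < length p \<longrightarrow> open_at (arcs E) C (p ! k) (p ! Suc k) (p ! Suc (Suc k)))"
    (is "(\<forall>k. ?P k) \<longleftrightarrow> (\<forall>k. ?Q k)")
  proof -
    \<comment> \<open>Active paths index a triple by its middle vertex, trails by its first; index 0
      is never interior.\<close>
    have "?P 0" "\<And>k. ?P (Suc k) \<longleftrightarrow> ?Q k"
      by (auto simp: collider_at_def open_at_def)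
    then show ?thesis by (metis not0_implies_Suc)
  qed
  then show ?thesis
    unfolding active_path_def upath_def trail_iff adj_def by blast
qed

section \<open>Distance to the conditioning set\<close>

text \<open>The length of a shortest directed path from \<open>x\<close> to \<open>C\<close>. If
  there is none, \<open>LEAST\<close> yields an unspecified value, whence the reachability
  hypotheses below.\<close>

definition dist_to :: "('a \<times> 'a) set \<Rightarrow> 'a set \<Rightarrow> 'a \<Rightarrow> nat" where
  "dist_to R C x = (LEAST n. \<exists>c\<in>C. (x, c) \<in> R ^^ n)"

lemma dist_to_le:
  assumes "(x, y) \<in> R" and "\<exists>c\<in>C. (y, c) \<in> R\<^sup>*"
  shows "dist_to R C x \<le> Suc (dist_to R C y)"
proof -
  have "\<exists>n. \<exists>c\<in>C. (y, c) \<in> R ^^ n" using assms(2) by (auto simp: rtrancl_power)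
  then have "\<exists>c\<in>C. (y, c) \<in> R ^^ dist_to R C y" unfolding dist_to_def by (rule LeastI_ex)
  then have "\<exists>c\<in>C. (x, c) \<in> R ^^ Suc (dist_to R C y)" using assms(1) by (metis relpow_Suc_I2)
  then show ?thesis unfolding dist_to_def[of R C x] by (rule Least_le)
qed

lemma dist_to_step:
  assumes "\<exists>c\<in>C. (x, c) \<in> R\<^sup>*" and "x \<notin> C"
  obtains y where "(x, y) \<in> R" "\<exists>c\<in>C. (y, c) \<in> R\<^sup>*" "dist_to R C x = Suc (dist_to R C y)"
proof -
  have "\<exists>n. \<exists>c\<in>C. (x, c) \<in> R ^^ n" using assms(1) by (auto simp: rtrancl_power)
  then have "\<exists>c\<in>C. (x, c) \<in> R ^^ dist_to R C x" unfolding dist_to_def by (rule LeastI_ex)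
  then obtain c where c: "c \<in> C" "(x, c) \<in> R ^^ dist_to R C x" by blast
  with assms(2) obtain n where n: "dist_to R C x = Suc n" by (cases "dist_to R C x") auto
  with c obtain y where y: "(x, y) \<in> R" "(y, c) \<in> R ^^ n" by (metis relpow_Suc_D2)
  then have yC: "\<exists>c\<in>C. (y, c) \<in> R\<^sup>*" using c(1) relpow_imp_rtrancl by blast
  have "dist_to R C y \<le> n" unfolding dist_to_def using y(2) c(1) by (auto intro: Least_le)
  with dist_to_le[OF y(1) yC] n have "dist_to R C x = Suc (dist_to R C y)" by simp
  with y(1) yC show thesis by (rule that)
qed

section \<open>Transfer between graphs with equal skeleton and v-structures\<close>

definition same_skeleton :: "('a \<times> 'a) set \<Rightarrow> ('a \<times> 'a) set \<Rightarrow> bool" where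
  "same_skeleton R S \<longleftrightarrow> (\<forall>x y. adj R x y \<longleftrightarrow> adj S x y)"

definition v_structure :: "('a \<times> 'a) set \<Rightarrow> 'a \<Rightarrow> 'a \<Rightarrow> 'a \<Rightarrow> bool" where
  "v_structure R x y z \<longleftrightarrow> (x, y) \<in> R \<and> (z, y) \<in> R \<and> x \<noteq> z \<and> \<not> adj R x z"

definition same_v_structures :: "('a \<times> 'a) set \<Rightarrow> ('a \<times> 'a) set \<Rightarrow> bool" where
  "same_v_structures R S \<longleftrightarrow> (\<forall>x y z. v_structure R x y z \<longleftrightarrow> v_structure S x y z)"

lemma acyclic_asym: "acyclic R \<Longrightarrow> (x, y) \<in> R \<Longrightarrow> (y, x) \<notin> R"
  unfolding acyclic_def using trancl.intros by metis

lemma acyclic_triangle: "acyclic R \<Longrightarrow> (x, y) \<in> R \<Longrightarrow> (y, z) \<in> R \<Longrightarrow> (z, x) \<notin> R"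
  unfolding acyclic_def using trancl.intros by metis

lemma acyclic_transitive_arc:
  assumes "acyclic R" "(x, y) \<in> R" "(y, z) \<in> R" "adj R x z"
  shows "(x, z) \<in> R"
  using acyclic_triangle[OF assms(1-3)] assms(4) by (simp add: adj_def)

text \<open>Were the second arc reversed in \<open>S\<close>, then \<open>x\<close>,
  \<open>y\<close>, \<open>z\<close> would form a v-structure of \<open>S\<close> and hence of
  \<open>R\<close>, against the arc from \<open>y\<close> to \<open>z\<close>.\<close>

lemma unshielded_chain_transfer:
  assumes "acyclic R" "same_skeleton R S" "same_v_structures R S"
    and "(x, y) \<in> R" "(y, z) \<in> R" "\<not> adj R x z" "(x, y) \<in> S"
  shows "(y, z) \<in> S"
proof (rule ccontr)
  assume "(y, z) \<notin> S"
  moreover have "adj S y z" using assms(2,5) by (auto simp: same_skeleton_def adj_def)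
  ultimately have "(z, y) \<in> S" by (auto simp: adj_def)
  moreover have "x \<noteq> z" using assms(1,4,5) acyclic_asym by metis
  ultimately have "v_structure S x y z"
    using assms(2,6,7) by (auto simp: v_structure_def same_skeleton_def)
  then have "(z, y) \<in> R" using assms(3) by (auto simp: same_v_structures_def v_structure_def)
  then show False using assms(1,5) acyclic_asym by metis
qed

text \<open>A shortest directed path to \<open>C\<close> has no chord that skips one vertex, so the
  common arc from \<open>x\<close> to \<open>y\<close> forces the orientation of every later arc in
  \<open>S\<close>.\<close>

lemma ancestor_transfer:
  assumes "acyclic R" "same_skeleton R S" "same_v_structures R S"
    and "(x, y) \<in> R" "(x, y) \<in> S" "\<exists>c\<in>C. (y, c) \<in> R\<^sup>*" "dist_to R C x = Suc (dist_to R C y)"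
  shows "\<exists>c\<in>C. (y, c) \<in> S\<^sup>*"
  using assms(4-)
proof (induction "dist_to R C y" arbitrary: x y rule: less_induct)
  case less
  show ?case
  proof (cases "y \<in> C")
    case False
    with less.prems(3) obtain z where z: "(y, z) \<in> R" "\<exists>c\<in>C. (z, c) \<in> R\<^sup>*"
      "dist_to R C y = Suc (dist_to R C z)" by (rule dist_to_step)
    have "(x, z) \<notin> R" using dist_to_le[OF _ z(2), of x] z(3) less.prems(4) by auto
    then have "\<not> adj R x z" using acyclic_transitive_arc[OF assms(1) less.prems(1) z(1)] by auto
    then have yz: "(y, z) \<in> S"
      using unshielded_chain_transfer[OF assms(1-3) less.prems(1) z(1)] less.prems(2) by auto
    have "\<exists>c\<in>C. (z, c) \<in> S\<^sup>*"
      using less.hyps[of z y] z yz by simp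
    then show ?thesis using yz by (auto intro: converse_rtrancl_into_rtrancl)
  qed auto
qed

text \<open>A shielded chain or collider can be bypassed, whereas a shielded fork can resist only
  if the bypass would turn a conditioned collider into a non-collider.\<close>

lemma shortest_trail_shielded:
  assumes ac: "acyclic R" and p: "trail R C (xs @ u # v # w # ys)"
    and short: "\<And>q. trail R C q \<Longrightarrow> hd q = hd (xs @ u # v # w # ys) \<Longrightarrow>
        last q = last (xs @ u # v # w # ys) \<Longrightarrow> length (xs @ u # v # w # ys) \<le> length q"
    and uw: "(u, w) \<in> R"
  shows "(v, u) \<in> R \<and> (v, w) \<in> R \<and> xs \<noteq> [] \<and> (last xs, u) \<in> R \<and> u \<in> C"
proof (rule ccontr)
  assume neg: "\<not> ?thesis"
  have local: "adj R u v" "adj R v w" "open_at R C u v w"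
    "xs \<noteq> [] \<Longrightarrow> open_at R C (last xs) u v"
    "ys \<noteq> [] \<Longrightarrow> open_at R C v w (hd ys)"
    using p trail_join[of R C xs u "v # w # ys"]
    by (auto simp: trail_Cons[of R C u] trail_Cons[of R C v] trail_Cons[of R C w])
  have wu: "(w, u) \<notin> R" using acyclic_asym[OF ac uw] .
  \<comment> \<open>Bypassing \<open>v\<close> contradicts minimality. Activity at \<open>w\<close>
    always survives; at \<open>u\<close> it is lost only if \<open>u\<close> is a collider in
    \<open>C\<close>, and then acyclicity orients \<open>v\<close> towards \<open>w\<close> as
    well.\<close>
  have "trail R C (xs @ u # w # ys)"
  proof (rule trail_shortcut[OF p])
    show "adj R u w" using uw by (simp add: adj_def)
  next
    assume xs: "xs \<noteq> []" and o: "open_at R C (last xs) u v"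
    show "open_at R C (last xs) u w"
      using o neg wu acyclic_triangle[OF ac uw, of v] local(1,2) xs
      by (auto simp: open_at_def adj_def split: if_splits)
  next
    assume ys: "ys \<noteq> []" and o: "open_at R C v w (hd ys)"
    show "open_at R C u w (hd ys)"
    proof (cases "(v, w) \<in> R")
      case True
      then show ?thesis using o uw by (simp add: open_at_def)
    next
      case False
      then have wv: "(w, v) \<in> R" using local(2) by (simp add: adj_def)
      then have "(v, u) \<notin> R" using acyclic_triangle[OF ac uw] by simp
      then have "(u, v) \<in> R" using local(1) by (simp add: adj_def)
      \<comment> \<open>Here \<open>v\<close> is a collider, and \<open>w\<close> inherits its
        descendant in \<open>C\<close>. As \<open>w\<close> is also outside \<open>C\<close>, it is
        open whether or not it becomes a collider.\<close>
      then have "\<exists>c\<in>C. (v, c) \<in> R\<^sup>*" using local(3) wv by (simp add: open_at_def)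
      then have "\<exists>c\<in>C. (w, c) \<in> R\<^sup>*" using wv by (auto intro: converse_rtrancl_into_rtrancl)
      moreover have "w \<notin> C" using o False by (simp add: open_at_def)
      ultimately show ?thesis by (simp add: open_at_def)
    qed
  qed
  moreover have "hd (xs @ u # w # ys) = hd (xs @ u # v # w # ys)" by (cases xs) auto
  ultimately show False using short[of "xs @ u # w # ys"] by simp
qed

lemma shortest_trail_shielded_rev:
  assumes ac: "acyclic R" and p: "trail R C (xs @ u # v # w # ys)"
    and short: "\<And>q. trail R C q \<Longrightarrow> hd q = hd (xs @ u # v # w # ys) \<Longrightarrow>
        last q = last (xs @ u # v # w # ys) \<Longrightarrow> length (xs @ u # v # w # ys) \<le> length q"
    and wu: "(w, u) \<in> R"
  shows "(v, w) \<in> R \<and> (v, u) \<in> R \<and> ys \<noteq> [] \<and> (hd ys, w) \<in> R \<and> w \<in> C"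
proof -
  let ?p = "xs @ u # v # w # ys" and ?r = "rev ys @ w # v # u # rev xs"
  have r: "?r = rev ?p" by simp
  have "(v, w) \<in> R \<and> (v, u) \<in> R \<and> rev ys \<noteq> [] \<and> (last (rev ys), w) \<in> R \<and> w \<in> C"
  proof (rule shortest_trail_shielded[OF ac _ _ wu])
    show "trail R C ?r" using p by (simp only: r trail_rev)
    show "length ?r \<le> length q"
      if q: "trail R C q" "hd q = hd ?r" "last q = last ?r" for q
    proof -
      have ne: "q \<noteq> []" "?p \<noteq> []" using q(1) by auto
      have "length ?p \<le> length (rev q)"
      proof (rule short)
        show "trail R C (rev q)" using q(1) by (simp only: trail_rev)
        show "hd (rev q) = hd ?p" using q(3) ne by (simp only: r hd_rev last_rev)
        show "last (rev q) = last ?p" using q(2) ne by (simp only: r hd_rev last_rev)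
      qed
      then show ?thesis by simp
    qed
  qed
  then show ?thesis by (simp add: last_rev)
qed

text \<open>The trail found in \<open>S\<close> is a trail of \<open>R\<close> with the given ends
  that minimises first the length, then \<open>cost\<close>.\<close>

lemma trail_transfer:
  assumes ac: "acyclic R" "acyclic S" and skel: "same_skeleton R S"
    and vs: "same_v_structures R S" and p0: "trail R C p0"
  shows "\<exists>p. distinct p \<and> trail S C p \<and> hd p = hd p0 \<and> last p = last p0"
proof -
  \<comment> \<open>Unspecified distances are harmless: \<open>cost\<close> is only compared for
    trails that differ in one vertex, and both candidates for that vertex reach
    \<open>C\<close>.\<close>
  define cost where "cost q = sum_list (map (dist_to R C) q)" for q
  define T where "T = {q. trail R C q \<and> hd q = hd p0 \<and> last q = last p0}"
  have "p0 \<in> T" using p0 by (simp add: T_def)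
  then obtain p where pT: "p \<in> T" and pmin: "\<And>q. (q, p) \<in> measures [length, cost] \<Longrightarrow> q \<notin> T"
    by (rule wfE_min[OF wf_measures]) blast
  have p: "trail R C p" "hd p = hd p0" "last p = last p0" using pT by (auto simp: T_def)
  have short: "length p \<le> length q" if "trail R C q" "hd q = hd p" "last q = last p" for q
    using that p pmin[of q] by (force simp: T_def not_le)
  have dist: "distinct p"
  proof (rule ccontr)
    assume "\<not> distinct p"
    then obtain xs x ys zs where d: "p = xs @ [x] @ ys @ [x] @ zs"
      using not_distinct_decomp by blast
    have "trail R C (xs @ x # zs)"
      using trail_cut_cycle[OF ac(1), of C xs x ys zs] p(1) d by simp
    moreover have "hd (xs @ x # zs) = hd p" using d by (cases xs) auto
    moreover have "last (xs @ x # zs) = last p" using d by simp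
    ultimately show False using short[of "xs @ x # zs"] d by simp
  qed
  have collider: "v_structure R u v w"
    if d: "p = xs @ u # v # w # ys" and c: "(u, v) \<in> R" "(w, v) \<in> R" for xs u v w ys
  proof -
    \<comment> \<open>A shielded triple on a shortest trail is a fork, which a collider is
      not.\<close>
    note s = p(1)[unfolded d] short[unfolded d]
    have "(u, w) \<notin> R"
      using shortest_trail_shielded[OF ac(1) s] c(1) acyclic_asym[OF ac(1)] by blast
    moreover have "(w, u) \<notin> R"
      using shortest_trail_shielded_rev[OF ac(1) s] c(1) acyclic_asym[OF ac(1)] by blast
    moreover have "u \<noteq> w" using dist d by auto
    ultimately show ?thesis using c by (simp add: v_structure_def adj_def)
  qed
  have open_S: "open_at S C u v w" if d: "p = xs @ u # v # w # ys" for xs u v w ys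
  proof -
    note s = p(1)[unfolded d] short[unfolded d]
    have local: "trail R C (xs @ [u])" "adj R u v" "adj R v w" "open_at R C u v w"
        "trail R C (w # ys)"
        "xs \<noteq> [] \<Longrightarrow> open_at R C (last xs) u v"
        "ys \<noteq> [] \<Longrightarrow> open_at R C v w (hd ys)"
      using p(1) d trail_join[of R C xs u "v # w # ys"]
      by (auto simp: trail_Cons[of R C u] trail_Cons[of R C v] trail_Cons[of R C w])
    show ?thesis
    proof (cases "(u, v) \<in> R \<and> (w, v) \<in> R")
      case True
      then have v: "v_structure R u v w" using collider d by blast
      then have vS: "(u, v) \<in> S" "(w, v) \<in> S"
        using vs by (auto simp: same_v_structures_def v_structure_def)
      have anc: "\<exists>c\<in>C. (v, c) \<in> R\<^sup>*" using local(4) True by (simp add: open_at_def)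
      have "\<exists>c\<in>C. (v, c) \<in> S\<^sup>*"
      proof (cases "v \<in> C")
        case False
        with anc obtain x where x: "(v, x) \<in> R" "\<exists>c\<in>C. (x, c) \<in> R\<^sup>*"
          "dist_to R C v = Suc (dist_to R C x)" by (rule dist_to_step)
        \<comment> \<open>Otherwise \<open>x\<close> is a common child of \<open>u\<close> and
          \<open>w\<close> too, and replacing \<open>v\<close> by \<open>x\<close> keeps the length
          but lowers \<open>cost\<close>. Neither \<open>u\<close> nor \<open>w\<close> is a
          collider before or after the exchange.\<close>
        have "\<not> (adj R u x \<and> adj R w x)"
        proof
          assume a: "adj R u x \<and> adj R w x"
          then have ux: "(u, x) \<in> R" "(w, x) \<in> R"
            using acyclic_transitive_arc[OF ac(1) _ x(1)] True by auto
          have asym: "(v, u) \<notin> R" "(v, w) \<notin> R" "(x, u) \<notin> R" "(x, w) \<notin> R"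
            using True ux acyclic_asym[OF ac(1)] by blast+
          let ?q = "xs @ u # x # w # ys"
          have "open_at R C u x w" using ux x(2) by (simp add: open_at_def)
          moreover have "open_at R C (last xs) u x" if "xs \<noteq> []"
            using local(6)[OF that] asym by (simp add: open_at_def)
          moreover have "open_at R C x w (hd ys)" if "ys \<noteq> []"
            using local(7)[OF that] asym by (simp add: open_at_def)
          ultimately have "trail R C ?q"
            using local(1,5) a unfolding trail_join[of R C xs u "x # w # ys"]
            by (auto simp: trail_Cons[of R C u] trail_Cons[of R C x] adj_sym[of R x])
          moreover have "hd ?q = hd p" using d by (cases xs) auto
          ultimately have "?q \<in> T" using p d by (simp add: T_def)
          moreover have "cost ?q < cost p" using d x(3) by (simp add: cost_def)
          ultimately show False using pmin[of ?q] d by simp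
        qed
        \<comment> \<open>One of \<open>u\<close>, \<open>w\<close> is not adjacent to
          \<open>x\<close>, which gives an unshielded chain through \<open>v\<close>.\<close>
        then have vx: "(v, x) \<in> S"
          using unshielded_chain_transfer[OF ac(1) skel vs _ x(1)] True vS by blast
        have "\<exists>c\<in>C. (x, c) \<in> S\<^sup>*"
          by (rule ancestor_transfer[OF ac(1) skel vs x(1) vx x(2,3)])
        then show ?thesis using vx by (auto intro: converse_rtrancl_into_rtrancl)
      qed auto
      then show ?thesis using vS by (simp add: open_at_def)
    next
      case False
      then have "v \<notin> C" using local(4) by (simp add: open_at_def)
      moreover have "\<not> ((u, v) \<in> S \<and> (w, v) \<in> S)"
      proof
        assume c: "(u, v) \<in> S \<and> (w, v) \<in> S"
        have "u \<noteq> w" using dist d by auto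
        then have "\<not> \<not> adj R u w"
          using False c vs skel by (auto simp: same_v_structures_def v_structure_def same_skeleton_def)
        then consider "(u, w) \<in> R" | "(w, u) \<in> R" by (auto simp: adj_def)
        then show False
        proof cases
          case 1
          from shortest_trail_shielded[OF ac(1) s 1]
          have f: "(v, u) \<in> R" "xs \<noteq> []" "(last xs, u) \<in> R" by auto
          \<comment> \<open>The shielded fork at \<open>v\<close> makes \<open>u\<close> a collider
            of the trail, hence the centre of a v-structure; this fixes the arc from
            \<open>v\<close> to \<open>u\<close> in \<open>S\<close>.\<close>
          have "p = butlast xs @ last xs # u # v # w # ys" using d f(2) by simp
          from collider[OF this f(3,1)] have "(v, u) \<in> S"
            using vs by (auto simp: same_v_structures_def v_structure_def)
          with c show False using acyclic_asym[OF ac(2)] by blast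
        next
          case 2
          from shortest_trail_shielded_rev[OF ac(1) s 2]
          have f: "(v, w) \<in> R" "ys \<noteq> []" "(hd ys, w) \<in> R" by auto
          have "p = (xs @ [u]) @ v # w # hd ys # tl ys" using d f(2) by simp
          from collider[OF this f(1,3)] have "(v, w) \<in> S"
            using vs by (auto simp: same_v_structures_def v_structure_def)
          with c show False using acyclic_asym[OF ac(2)] by blast
        qed
      qed
      ultimately show ?thesis by (auto simp: open_at_def)
    qed
  qed
  have "trail S C p"
    unfolding trail_iff
  proof (intro conjI allI impI)
    show "p \<noteq> []" using p(1) by auto
    show "adj S (p ! k) (p ! Suc k)" if "Suc k < length p" for k
      using p(1) skel that unfolding trail_iff by (auto simp: same_skeleton_def)
    show "open_at S C (p ! k) (p ! Suc k) (p ! Suc (Suc k))" if "Suc (Suc k) < length p" for k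
    proof (rule open_S)
      show "p = take k p @ p ! k # p ! Suc k # p ! Suc (Suc k) # drop (Suc (Suc (Suc k))) p"
        using that by (simp add: Cons_nth_drop_Suc)
    qed
  qed
  with dist p show ?thesis by blast
qed

lemma markov_equivalentI:
  assumes "dag E" "dag F" "same_skeleton (arcs E) (arcs F)"
    "same_v_structures (arcs E) (arcs F)"
  shows "markov_equivalent E F"
proof -
  have ac: "acyclic (arcs E)" "acyclic (arcs F)" using assms(1,2) by (auto simp: dag_def)
  have sym: "same_skeleton (arcs F) (arcs E)" "same_v_structures (arcs F) (arcs E)"
    using assms(3,4) by (auto simp: same_skeleton_def same_v_structures_def)
  show ?thesis
    unfolding markov_equivalent_def d_separated_def active_path_iff
    using trail_transfer[OF ac assms(3,4)] trail_transfer[OF ac(2,1) sym] by metis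
qed

section \<open>Skeletons and v-structures of Lyapunov models\<close>

text \<open>In a topological order \<open>M\<close> is triangular, so its eigenvalues are diagonal
  entries: an eigenvector for any other value vanishes coordinate by coordinate, parents before
  children.\<close>

lemma stable_dag:
  assumes E: "acyclic (arcs E)" and M: "M \<in> edge_matrices E" and neg: "\<And>i. M $ i $ i < 0"
  shows "stable M"
  unfolding stable_def complex_eigenvalue_def
proof (intro allI impI, elim exE conjE)
  fix l and x :: "complex ^ 'a"
  assume x: "x \<noteq> 0" and eig: "map_matrix complex_of_real M *v x = l *s x"
  show "Re l < 0"
  proof (rule ccontr)
    assume "\<not> Re l < 0"
    then have l: "l \<noteq> complex_of_real (M $ i $ i)" for i
      using neg[of i] by auto
    have wf: "wf (arcs E)" using E by (intro finite_acyclic_wf) simp_all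
    have "x $ i = 0" for i
    proof (induction i rule: wf_induct_rule[OF wf])
      case (1 i)
      have "(\<Sum>j\<in>UNIV. complex_of_real (M $ i $ j) * x $ j)
          = (\<Sum>j\<in>UNIV. if j = i then complex_of_real (M $ i $ i) * x $ i else 0)"
      proof (rule sum.cong)
        fix j
        show "complex_of_real (M $ i $ j) * x $ j
            = (if j = i then complex_of_real (M $ i $ i) * x $ i else 0)"
          using 1[of j] M by (cases "(j, i) \<in> E") (auto simp: arcs_def edge_matrices_def)
      qed simp
      also have "\<dots> = complex_of_real (M $ i $ i) * x $ i" by simp
      finally have "complex_of_real (M $ i $ i) * x $ i = l * x $ i"
        using arg_cong[OF eig, of "\<lambda>v. v $ i"]
        by (simp add: matrix_vector_mult_def map_matrix_def)
      then show ?case using l[of i] by (metis mult_right_cancel)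
    qed
    then show False using x by (simp add: vec_eq_iff)
  qed
qed

lemma lyapunov_equation_entry:
  "M ** S + S ** transpose M + 2 *\<^sub>R mat 1 = (0 :: real ^ 'v ^ 'v::finite) \<longleftrightarrow>
     (\<forall>r c. (\<Sum>d\<in>UNIV. M $ r $ d * S $ d $ c) + (\<Sum>d\<in>UNIV. M $ c $ d * S $ r $ d)
        + (if r = c then 2 else 0) = 0)"
  by (auto simp: vec_eq_iff matrix_matrix_mult_def transpose_def mat_def mult.commute)

lemma lyapunov_model_entry_eq_0:
  assumes S: "S \<in> lyapunov_model E"
    and i: "\<And>c. (c, i) \<in> arcs E \<Longrightarrow> S $ c $ i = 0 \<and> S $ c $ j = 0"
    and j: "\<And>c. (c, j) \<in> arcs E \<Longrightarrow> S $ c $ i = 0 \<and> S $ c $ j = 0"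
    and "i \<noteq> j"
  shows "S $ i $ j = 0"
proof -
  from S obtain M where sym: "transpose S = S" and pd: "\<And>x. x \<noteq> 0 \<Longrightarrow> x \<bullet> (S *v x) > 0"
    and M: "M \<in> edge_matrices E" and eq: "M ** S + S ** transpose M + 2 *\<^sub>R mat 1 = 0"
    by (auto simp: lyapunov_model_def positive_definite_def)
  have sym': "S $ r $ c = S $ c $ r" for r c
    using arg_cong[OF sym, of "\<lambda>A. A $ c $ r"] by (simp add: transpose_def)
  have diag: "S $ r $ r > 0" for r
    using pd[of "axis r 1"]
    by (simp add: axis_eq_0_iff inner_axis' matrix_vector_mul_component inner_axis)
  have row: "(\<Sum>d\<in>UNIV. M $ r $ d * S $ d $ c) = M $ r $ r * S $ r $ c"
    if "\<And>d. (d, r) \<in> arcs E \<Longrightarrow> S $ d $ c = 0" for r c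
  proof -
    have "(\<Sum>d\<in>UNIV. M $ r $ d * S $ d $ c)
        = (\<Sum>d\<in>UNIV. if d = r then M $ r $ r * S $ r $ c else 0)"
    proof (rule sum.cong)
      fix d
      show "M $ r $ d * S $ d $ c = (if d = r then M $ r $ r * S $ r $ c else 0)"
        using that[of d] M by (cases "(d, r) \<in> E") (auto simp: arcs_def edge_matrices_def)
    qed simp
    then show ?thesis by simp
  qed
  have row': "(\<Sum>d\<in>UNIV. M $ r $ d * S $ c $ d) = M $ r $ r * S $ r $ c"
    if "\<And>d. (d, r) \<in> arcs E \<Longrightarrow> S $ d $ c = 0" for r c
    using row[OF that] by (simp add: sym'[of c])
  have ent: "(\<Sum>d\<in>UNIV. M $ r $ d * S $ d $ c) + (\<Sum>d\<in>UNIV. M $ c $ d * S $ r $ d)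
        + (if r = c then 2 else 0) = 0" for r c
    using eq unfolding lyapunov_equation_entry by blast
  \<comment> \<open>The diagonal entry of the equation reads
    \<open>2 * M $ r $ r * S $ r $ r + 2 = 0\<close>, and \<open>S $ r $ r\<close> is
    positive.\<close>
  have neg: "M $ r $ r < 0" if "\<And>d. (d, r) \<in> arcs E \<Longrightarrow> S $ d $ r = 0" for r
  proof -
    have "M $ r $ r * S $ r $ r = - 1"
      using ent[of r r] row[OF that] row'[OF that] by simp
    then show ?thesis using diag[of r]
      by (metis mult_nonneg_nonneg less_le not_le neg_0_le_iff_le not_one_le_zero)
  qed
  have "(M $ i $ i + M $ j $ j) * S $ i $ j = 0"
    using ent[of i j] row[of i j] row'[of j i] i j \<open>i \<noteq> j\<close> sym'[of i j] by (simp add: algebra_simps)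
  moreover have "M $ i $ i < 0" "M $ j $ j < 0" using neg i j by blast+
  ultimately show ?thesis by auto
qed

section \<open>Witness matrices for an edge, a chain and a fork\<close>

text \<open>A bound by a multiple of the squared norm avoids singling out a nonzero coordinate, and
  explicit sums can be evaluated entrywise.\<close>

lemma positive_definiteI:
  assumes "\<And>r c. S $ r $ c = S $ c $ r" and "e > 0"
    and "\<And>x. e * (\<Sum>r\<in>UNIV. (x $ r)\<^sup>2) \<le> (\<Sum>r\<in>UNIV. x $ r * (\<Sum>c\<in>UNIV. S $ r $ c * x $ c))"
  shows "positive_definite S"
  unfolding positive_definite_def
proof (intro conjI allI impI)
  show "transpose S = S" using assms(1) by (simp add: transpose_def vec_eq_iff)
  fix x :: "real ^ 'a"
  assume "x \<noteq> 0"
  then have "0 < e * (x \<bullet> x)" using assms(2) by simp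
  also have "\<dots> \<le> x \<bullet> (S *v x)"
    using assms(3)[of x] by (simp add: inner_vec_def matrix_vector_mult_def power2_eq_square)
  finally show "0 < x \<bullet> (S *v x)" .
qed

lemma if_distribs: "(if P then a else b) * x = (if P then a * x else b * x)"
  "x * (if P then a else b) = (if P then x * a else x * b)"
  for a b x :: real
  by auto

text \<open>The witnesses solve the Lyapunov equation for \<open>M = A - I\<close>, where \<open>A\<close> is the 0-1
  adjacency matrix of a subgraph consisting of an edge, a chain or a fork.\<close>

lemma lyapunov_model_edge:
  assumes E: "dag E" and ab: "(a, b) \<in> arcs E"
  obtains S where "S \<in> lyapunov_model E" "S $ a $ b \<noteq> 0"
    "\<And>r c. r \<noteq> c \<Longrightarrow> r \<notin> {a, b} \<Longrightarrow> S $ r $ c = 0"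
proof -
  have ne: "a \<noteq> b" "b \<noteq> a" using ab by (auto simp: arcs_def)
  \<comment> \<open>Entries are sums of conditionals that test the column first, so that sums over
    columns collapse.\<close>
  define M :: "real ^ 'a ^ 'a" where
    "M = (\<chi> r c. (if c = r then -1 else 0) + (if c = a then if r = b then 1 else 0 else 0))"
  \<comment> \<open>The equation is solved from the source on: \<open>s_aa = 1\<close>,
    \<open>2 s_ab = s_aa\<close>, \<open>s_bb = 1 + s_ab = 3/2\<close>.\<close>
  define S :: "real ^ 'a ^ 'a" where
    "S = (\<chi> r c. (if c = r then 1 else 0) + (if c = a then (if r = b then 1/2 else 0) else 0)
       + (if c = b then (if r = a then 1/2 else 0) + (if r = b then 1/2 else 0) else 0))"
  have row: "(\<Sum>d\<in>UNIV. M $ r $ d * g d) = - g r + (if r = b then g a else 0)"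
    for r and g :: "'a \<Rightarrow> real"
    using ne by (auto simp: M_def distrib_right sum.distrib if_distribs cong: if_cong)
  have M: "M \<in> edge_matrices E"
    using E ab by (auto simp: M_def edge_matrices_def dag_def digraph_def arcs_def)
  have "stable M"
    using E M ne by (intro stable_dag) (auto simp: dag_def M_def)
  moreover have "M ** S + S ** transpose M + 2 *\<^sub>R mat 1 = 0"
    unfolding lyapunov_equation_entry row using ne by (auto simp: S_def)
  moreover have "positive_definite S"
  proof (rule positive_definiteI[where e = "1/2"])
    fix x :: "real ^ 'a"
    have "(\<Sum>r\<in>{a, b}. (x $ r)\<^sup>2) \<le> (\<Sum>r\<in>UNIV. (x $ r)\<^sup>2)" by (rule sum_mono2) auto
    then have "(x $ a)\<^sup>2 + (x $ b)\<^sup>2 \<le> (\<Sum>r\<in>UNIV. (x $ r)\<^sup>2)" using ne by simp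
    moreover have "(\<Sum>r\<in>UNIV. x $ r * (\<Sum>c\<in>UNIV. S $ r $ c * x $ c))
        = (\<Sum>r\<in>UNIV. (x $ r)\<^sup>2) + x $ a * x $ b + (x $ b)\<^sup>2 / 2"
      using ne by (simp add: S_def distrib_left distrib_right sum.distrib if_distribs
          power2_eq_square cong: if_cong)
    moreover have "0 \<le> (x $ a + x $ b)\<^sup>2" by simp
    then have "0 \<le> (x $ a)\<^sup>2 + 2 * (x $ a * x $ b) + (x $ b)\<^sup>2" by (simp add: power2_sum)
    ultimately show "1/2 * (\<Sum>r\<in>UNIV. (x $ r)\<^sup>2)
        \<le> (\<Sum>r\<in>UNIV. x $ r * (\<Sum>c\<in>UNIV. S $ r $ c * x $ c))"
      using zero_le_power2[of "x $ b"] by linarith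
  qed (auto simp: S_def)
  ultimately have "S \<in> lyapunov_model E" using M by (auto simp: lyapunov_model_def)
  moreover have "S $ a $ b \<noteq> 0" using ne by (simp add: S_def)
  ultimately show thesis by (rule that) (auto simp: S_def)
qed

lemma lyapunov_model_chain:
  assumes E: "dag E" and ak: "(a, k) \<in> arcs E" and kj: "(k, j) \<in> arcs E" and aj: "a \<noteq> j"
  obtains S where "S \<in> lyapunov_model E" "S $ a $ j \<noteq> 0"
    "\<And>r c. r \<noteq> c \<Longrightarrow> r \<notin> {a, k, j} \<Longrightarrow> S $ r $ c = 0"
proof -
  have ne: "a \<noteq> k" "k \<noteq> a" "k \<noteq> j" "j \<noteq> k" "a \<noteq> j" "j \<noteq> a"
    using ak kj aj by (auto simp: arcs_def)
  define M :: "real ^ 'a ^ 'a" where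
    "M = (\<chi> r c. (if c = r then -1 else 0) + (if c = a then if r = k then 1 else 0 else 0)
       + (if c = k then if r = j then 1 else 0 else 0))"
  \<comment> \<open>Along the chain: \<open>s_aj = s_ak / 2 = 1/4\<close>,
    \<open>s_kk = 3/2\<close>, \<open>s_kj = (s_aj + s_kk) / 2 = 7/8\<close> and
    \<open>s_jj = 1 + s_kj = 15/8\<close>.\<close>
  define S :: "real ^ 'a ^ 'a" where
    "S = (\<chi> r c. (if c = r then 1 else 0)
       + (if c = a then (if r = k then 1/2 else 0) + (if r = j then 1/4 else 0) else 0)
       + (if c = k then (if r = a then 1/2 else 0) + (if r = k then 1/2 else 0)
         + (if r = j then 7/8 else 0) else 0)
       + (if c = j then (if r = a then 1/4 else 0) + (if r = k then 7/8 else 0)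
         + (if r = j then 7/8 else 0) else 0))"
  have row: "(\<Sum>d\<in>UNIV. M $ r $ d * g d) = - g r + (if r = k then g a else 0) + (if r = j then g k else 0)"
    for r and g :: "'a \<Rightarrow> real"
    using ne by (auto simp: M_def distrib_right sum.distrib if_distribs cong: if_cong)
  have M: "M \<in> edge_matrices E"
    using E ak kj by (auto simp: M_def edge_matrices_def dag_def digraph_def arcs_def)
  have "stable M"
    using E M ne by (intro stable_dag) (auto simp: dag_def M_def)
  moreover have "M ** S + S ** transpose M + 2 *\<^sub>R mat 1 = 0"
    unfolding lyapunov_equation_entry row using ne by (auto simp: S_def)
  moreover have "positive_definite S"
  proof (rule positive_definiteI[where e = "1/8"])
    fix x :: "real ^ 'a"
    have "(\<Sum>r\<in>{a, k, j}. (x $ r)\<^sup>2) \<le> (\<Sum>r\<in>UNIV. (x $ r)\<^sup>2)" by (rule sum_mono2) auto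
    then have "(x $ a)\<^sup>2 + (x $ k)\<^sup>2 + (x $ j)\<^sup>2 \<le> (\<Sum>r\<in>UNIV. (x $ r)\<^sup>2)" using ne by simp
    moreover have "(\<Sum>r\<in>UNIV. x $ r * (\<Sum>c\<in>UNIV. S $ r $ c * x $ c))
        = (\<Sum>r\<in>UNIV. (x $ r)\<^sup>2) + x $ a * x $ k + (x $ k)\<^sup>2 / 2 + x $ a * x $ j / 2
          + 7/4 * (x $ k * x $ j) + 7/8 * (x $ j)\<^sup>2"
      using ne by (simp add: S_def distrib_left distrib_right sum.distrib if_distribs
          power2_eq_square mult_ac cong: if_cong)
    \<comment> \<open>An eighth of this sum has the cross terms of the form. It takes 11/8 of the
      coefficient 3/2 of the square at \<open>k\<close>, which leaves exactly the bound 1/8.\<close>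
    moreover have "0 \<le> 4 * (x $ a + x $ k)\<^sup>2 + 2 * (x $ a + x $ j)\<^sup>2 + 7 * (x $ k + x $ j)\<^sup>2"
      by simp
    then have "0 \<le> 6 * (x $ a)\<^sup>2 + 11 * (x $ k)\<^sup>2 + 9 * (x $ j)\<^sup>2
        + 8 * (x $ a * x $ k) + 4 * (x $ a * x $ j) + 14 * (x $ k * x $ j)"
      by (simp add: power2_sum algebra_simps)
    ultimately show "1/8 * (\<Sum>r\<in>UNIV. (x $ r)\<^sup>2)
        \<le> (\<Sum>r\<in>UNIV. x $ r * (\<Sum>c\<in>UNIV. S $ r $ c * x $ c))"
      using zero_le_power2[of "x $ a"] zero_le_power2[of "x $ k"] zero_le_power2[of "x $ j"]
      by linarith
  qed (auto simp: S_def)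
  ultimately have "S \<in> lyapunov_model E" using M by (auto simp: lyapunov_model_def)
  moreover have "S $ a $ j \<noteq> 0" using ne by (simp add: S_def)
  ultimately show thesis by (rule that) (auto simp: S_def)
qed

lemma lyapunov_model_fork:
  assumes E: "dag E" and ka: "(k, a) \<in> arcs E" and kj: "(k, j) \<in> arcs E" and aj: "a \<noteq> j"
  obtains S where "S \<in> lyapunov_model E" "S $ a $ j \<noteq> 0"
    "\<And>r c. r \<noteq> c \<Longrightarrow> r \<notin> {a, k, j} \<Longrightarrow> S $ r $ c = 0"
proof -
  have ne: "a \<noteq> k" "k \<noteq> a" "k \<noteq> j" "j \<noteq> k" "a \<noteq> j" "j \<noteq> a"
    using ka kj aj by (auto simp: arcs_def)
  define M :: "real ^ 'a ^ 'a" where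
    "M = (\<chi> r c. (if c = r then -1 else 0)
       + (if c = k then if r = a then 1 else if r = j then 1 else 0 else 0))"
  \<comment> \<open>From the root: \<open>s_kk = 1\<close>, \<open>s_ka = s_kj = 1/2\<close>,
    \<open>s_aj = (s_ka + s_kj) / 2 = 1/2\<close>, \<open>s_aa = s_jj = 3/2\<close>.\<close>
  define S :: "real ^ 'a ^ 'a" where
    "S = (\<chi> r c. (if c = r then 1 else 0)
       + (if c = a then (if r = a then 1/2 else 0) + (if r = k then 1/2 else 0)
         + (if r = j then 1/2 else 0) else 0)
       + (if c = k then (if r = a then 1/2 else 0)
         + (if r = j then 1/2 else 0) else 0)
       + (if c = j then (if r = a then 1/2 else 0) + (if r = k then 1/2 else 0)
         + (if r = j then 1/2 else 0) else 0))"
  have row: "(\<Sum>d\<in>UNIV. M $ r $ d * g d) = - g r + (if r = a then g k else 0) + (if r = j then g k else 0)"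
    for r and g :: "'a \<Rightarrow> real"
    using ne by (auto simp: M_def distrib_right sum.distrib if_distribs cong: if_cong)
  have M: "M \<in> edge_matrices E"
    using E ka kj by (auto simp: M_def edge_matrices_def dag_def digraph_def arcs_def)
  have "stable M"
    using E M ne by (intro stable_dag) (auto simp: dag_def M_def)
  moreover have "M ** S + S ** transpose M + 2 *\<^sub>R mat 1 = 0"
    unfolding lyapunov_equation_entry row using ne by (auto simp: S_def)
  moreover have "positive_definite S"
  proof (rule positive_definiteI[where e = "1/2"])
    fix x :: "real ^ 'a"
    have "(\<Sum>r\<in>{a, k, j}. (x $ r)\<^sup>2) \<le> (\<Sum>r\<in>UNIV. (x $ r)\<^sup>2)" by (rule sum_mono2) auto
    then have "(x $ a)\<^sup>2 + (x $ k)\<^sup>2 + (x $ j)\<^sup>2 \<le> (\<Sum>r\<in>UNIV. (x $ r)\<^sup>2)" using ne by simp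
    moreover have "(\<Sum>r\<in>UNIV. x $ r * (\<Sum>c\<in>UNIV. S $ r $ c * x $ c))
        = (\<Sum>r\<in>UNIV. (x $ r)\<^sup>2) + (x $ a)\<^sup>2 / 2 + (x $ j)\<^sup>2 / 2 + x $ a * x $ k
          + x $ a * x $ j + x $ k * x $ j"
      using ne by (simp add: S_def distrib_left distrib_right sum.distrib if_distribs
          power2_eq_square cong: if_cong)
    moreover have "0 \<le> (x $ a + x $ k + x $ j)\<^sup>2" by simp
    then have "0 \<le> (x $ a)\<^sup>2 + (x $ k)\<^sup>2 + (x $ j)\<^sup>2
        + 2 * (x $ a * x $ k) + 2 * (x $ a * x $ j) + 2 * (x $ k * x $ j)"
      by (simp add: power2_eq_square algebra_simps)
    ultimately show "1/2 * (\<Sum>r\<in>UNIV. (x $ r)\<^sup>2)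
        \<le> (\<Sum>r\<in>UNIV. x $ r * (\<Sum>c\<in>UNIV. S $ r $ c * x $ c))"
      using zero_le_power2[of "x $ a"] zero_le_power2[of "x $ k"] zero_le_power2[of "x $ j"]
      by linarith
  qed (auto simp: S_def)
  ultimately have "S \<in> lyapunov_model E" using M by (auto simp: lyapunov_model_def)
  moreover have "S $ a $ j \<noteq> 0" using ne by (simp add: S_def)
  ultimately show thesis by (rule that) (auto simp: S_def)
qed

section \<open>Recovering the skeleton and the v-structures\<close>

lemma lyapunov_model_skeleton:
  assumes "dag E" and eq: "lyapunov_model E = lyapunov_model F" and ab: "(a, b) \<in> arcs E"
  shows "adj (arcs F) a b"
proof (rule ccontr)
  assume n: "\<not> adj (arcs F) a b"
  obtain S where S: "S \<in> lyapunov_model E" "S $ a $ b \<noteq> 0"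
    "\<And>r c. r \<noteq> c \<Longrightarrow> r \<notin> {a, b} \<Longrightarrow> S $ r $ c = 0"
    using lyapunov_model_edge[OF assms(1) ab] by metis
  have "S $ a $ b = 0"
  proof (rule lyapunov_model_entry_eq_0)
    show "S \<in> lyapunov_model F" using S(1) eq by simp
    show "a \<noteq> b" using ab by (auto simp: arcs_def)
    show "S $ c $ a = 0 \<and> S $ c $ b = 0" if "(c, a) \<in> arcs F" for c
    proof -
      have "c \<notin> {a, b}" using that n by (auto simp: adj_def arcs_def)
      then show ?thesis using S(3) by auto
    qed
    show "S $ c $ a = 0 \<and> S $ c $ b = 0" if "(c, b) \<in> arcs F" for c
    proof -
      have "c \<notin> {a, b}" using that n by (auto simp: adj_def arcs_def)
      then show ?thesis using S(3) by auto
    qed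
  qed
  with S(2) show False by contradiction
qed

lemma lyapunov_model_same_skeleton:
  assumes "dag E" "dag F" and "lyapunov_model E = lyapunov_model F"
  shows "same_skeleton (arcs E) (arcs F)"
  unfolding same_skeleton_def
  using lyapunov_model_skeleton[OF assms(1,3)] lyapunov_model_skeleton[OF assms(2) assms(3)[symmetric]]
  by (metis adj_def)

lemma lyapunov_model_v_structure:
  assumes E: "dag E" and F: "dag F" and eq: "lyapunov_model E = lyapunov_model F"
    and v: "v_structure (arcs E) i k j"
  shows "v_structure (arcs F) i k j"
proof (rule ccontr)
  assume n: "\<not> v_structure (arcs F) i k j"
  have ij: "i \<noteq> j" "\<not> adj (arcs E) i j" and k: "(i, k) \<in> arcs E" "(j, k) \<in> arcs E"
    using v by (auto simp: v_structure_def)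
  have skel: "adj (arcs E) x y \<longleftrightarrow> adj (arcs F) x y" for x y
    using lyapunov_model_same_skeleton[OF E F eq] by (simp add: same_skeleton_def)
  have ac: "acyclic (arcs E)" using E by (simp add: dag_def)
  have zero: "S $ i $ j = 0 \<and> S $ j $ i = 0"
    if S: "S \<in> lyapunov_model F"
      and off: "\<And>r c. r \<noteq> c \<Longrightarrow> r \<notin> {i, k, j} \<Longrightarrow> S $ r $ c = 0" for S
  proof -
    \<comment> \<open>A parent of \<open>i\<close> or \<open>j\<close> in \<open>E\<close> is
      neither of them, by non-adjacency and absence of loops, nor their common child
      \<open>k\<close>, by acyclicity.\<close>
    have out: "c \<notin> {i, k, j}" if "(c, i) \<in> arcs E \<or> (c, j) \<in> arcs E" for c
      using that ij k acyclic_asym[OF ac] by (auto simp: adj_def)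
    have "S $ c $ i = 0 \<and> S $ c $ j = 0" if "(c, i) \<in> arcs E \<or> (c, j) \<in> arcs E" for c
      using off out[OF that] by auto
    then show ?thesis
      using lyapunov_model_entry_eq_0[of S E i j] lyapunov_model_entry_eq_0[of S E j i] S eq ij(1)
      by simp
  qed
  have "adj (arcs F) i k" "adj (arcs F) j k" using k skel by (auto simp: adj_def)
  \<comment> \<open>Both edges at \<open>k\<close> survive in \<open>F\<close> but do not collide
    there, so they form a chain in one direction or a fork.\<close>
  then consider "(i, k) \<in> arcs F" "(k, j) \<in> arcs F" | "(j, k) \<in> arcs F" "(k, i) \<in> arcs F"
    | "(k, i) \<in> arcs F" "(k, j) \<in> arcs F"
    using n ij skel by (auto simp: adj_def v_structure_def)
  then show False
  proof cases
    case 1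
    from lyapunov_model_chain[OF F this ij(1)] zero show False by metis
  next
    case 2
    from lyapunov_model_chain[OF F this ij(1)[symmetric]] zero show False
      by (metis insert_commute)
  next
    case 3
    from lyapunov_model_fork[OF F this ij(1)] zero show False by metis
  qed
qed

lemma model_equivalent_imp_markov_equivalent:
  assumes "dag E" "dag F" "lyapunov_model E = lyapunov_model F"
  shows "markov_equivalent E F"
proof (rule markov_equivalentI)
  show "same_v_structures (arcs E) (arcs F)"
    unfolding same_v_structures_def
    using lyapunov_model_v_structure[OF assms]
      lyapunov_model_v_structure[OF assms(2,1) assms(3)[symmetric]] by blast
qed (use assms lyapunov_model_same_skeleton in auto)

section \<open>Refinement of the partition into equivalence classes\<close>

lemma refines_quotient:
  assumes "equiv A r" "equiv A s" "r \<subseteq> s"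
  shows "refines A (A // r) (A // s)"
  unfolding refines_def
proof (intro conjI ballI)
  fix X assume "X \<in> A // r"
  then obtain x where "x \<in> A" "X = r `` {x}" by (rule quotientE)
  then have "s `` {x} \<in> A // s" "X \<subseteq> s `` {x}" using assms(3) by (auto intro: quotientI)
  then show "\<exists>Y\<in>A // s. X \<subseteq> Y" by blast
qed (use assms in \<open>auto intro: partition_on_quotient\<close>)

theorem corollary3p9:
  shows "(\<forall>G1 G2 :: ('v::finite \<times> 'v) set. dag G1 \<longrightarrow> dag G2 \<longrightarrow>
            lyapunov_model G1 = lyapunov_model G2 \<longrightarrow> markov_equivalent G1 G2)
       \<and> refines (dags :: ('v \<times> 'v) set set) model_classes markov_classes
       \<and> (\<forall>G1 G2 :: ('v \<times> 'v) set. dag G1 \<longrightarrow> dag G2 \<longrightarrow>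
            \<not> markov_equivalent G1 G2 \<longrightarrow> \<not> model_equivalent G1 G2)"
proof (intro conjI allI impI)
  show "markov_equivalent G1 G2"
    if "dag G1" "dag G2" "lyapunov_model G1 = lyapunov_model G2" for G1 G2 :: "('v \<times> 'v) set"
    by (rule model_equivalent_imp_markov_equivalent[OF that])
  then show "\<not> model_equivalent G1 G2"
    if "dag G1" "dag G2" "\<not> markov_equivalent G1 G2" for G1 G2 :: "('v \<times> 'v) set"
    using that by (auto simp: model_equivalent_def)
  show "refines (dags :: ('v \<times> 'v) set set) model_classes markov_classes"
    unfolding model_classes_def markov_classes_def
  proof (rule refines_quotient)
    show "equiv (dags :: ('v \<times> 'v) set set)
        {(E, F). E \<in> dags \<and> F \<in> dags \<and> model_equivalent E F}"
      by (intro equivI) (auto simp: refl_on_def sym_def trans_def model_equivalent_def)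
    show "equiv (dags :: ('v \<times> 'v) set set)
        {(E, F). E \<in> dags \<and> F \<in> dags \<and> markov_equivalent E F}"
      by (intro equivI) (auto simp: refl_on_def sym_def trans_def markov_equivalent_def)
    show "{(E, F). E \<in> dags \<and> F \<in> dags \<and> model_equivalent E F}
        \<subseteq> {(E, F :: ('v \<times> 'v) set). E \<in> dags \<and> F \<in> dags \<and> markov_equivalent E F}"
      using model_equivalent_imp_markov_equivalent by (auto simp: dags_def model_equivalent_def)
  qed
qed

end
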